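(* Let $p\geq 17$ be a prime with $\frac{p-1}{2}\equiv 0\pmod 4$, and let $\zeta_p:\{\xi\in\mathbb{Z}:\gcd(\xi,p)=1\}\to\{0,1\}$ be a function such that (1) if $\gcd(\theta_1,p)=\gcd(\theta_2,p)=1$ and $\theta_1\equiv\theta_2\pmod p$, then $\zeta_p(\theta_1)=\zeta_p(\theta_2)$; (2) the sets $A_i=\{a:\zeta_p(a)=i,\ 1\leq a\leq p-1\}$, $i=0,1$, satisfy $|A_0|=|A_1|=\frac{p-1}{2}$; and (3) $\zeta_p(\theta)=\frac{1+\chi_p(\theta)}{2}$ for a function $\chi_p:\{\xi\in\mathbb{Z}:\gcd(\xi,p)=1\}\to\{-1,1\}$ satisfying $\chi_p(\theta_1\theta_2)=\chi_p(\theta_1)\chi_p(\theta_2)$ for all $\theta_1,\theta_2$ relatively prime to $p$. Let $S=\{1,2,\ldots,p-1\}$. Then the join graph $P_{(p-1)/2}+C_{(p-1)/2}$ is an arithmetic cordial graph modulo $p$ under $\langle S,\zeta_p,\cdot\rangle$, where $\cdot$ is ordinary multiplication of integers.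
   Context: $P_n$ and $C_n$ denote the path graph and the cycle graph on $n$ vertices. Join graph: $G+H$ has vertex set $V(G)\cup V(H)$ (disjoint union) and edge set $E(G)\cup E(H)\cup\{ab:a\in V(G),\ b\in V(H)\}$. Arithmetic cordial graph: let $\eta$ be a positive integer, $S\subseteq\mathbb{Z}$, $\star:S\times S\to\mathbb{Z}$ a binary function, and $\zeta_\eta:\{\xi\in\mathbb{Z}:\gcd(\xi,\eta)=1\}\to\{0,1\}$ a function. The triple $\langle S,\zeta_\eta,\star\rangle$ is called an arithmetic structure. For a simple connected graph $\Gamma$ of order $N$, a bijection $f:V(\Gamma)\to S$ (where $|S|=N$) is an arithmetic cordial labeling modulo $\eta$ under $\langle S,\zeta_\eta,\star\rangle$ if the induced function $f_\eta^*:E(\Gamma)\to\{0,1\}$, defined by $f_\eta^*(ab)=0$ if $\gcd(f(a)\star f(b),\eta)\neq 1$ or $\zeta_\eta(f(a)\star f(b))=0$, and $f_\eta^*(ab)=1$ if $\gcd(f(a)\star f(b),\eta)=1$ and $\zeta_\eta(f(a)\star f(b))=1$, satisfies $|e_{f_\eta^*}(0)-e_{f_\eta^*}(1)|\leq 1$, where $e_{f_\eta^*}(i)$ is the number of edges with label $i$. A graph admitting such a labeling is an arithmetic cordial graph modulo $\eta$ under $\langle S,\zeta_\eta,\star\rangle$. *)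

theory Defs
  imports Complex_Main "HOL-Library.FuncSet" "HOL-Number_Theory.Cong"
begin

section \<open>Simple graphs\<close>

record 'a graph =
  verts :: "'a set"
  edges :: "'a set set"

definition simple_graph :: "'a graph \<Rightarrow> bool" where
  "simple_graph G \<longleftrightarrow> finite (verts G) \<and> (\<forall>e\<in>edges G. e \<subseteq> verts G \<and> card e = 2)"

definition adjacent :: "'a graph \<Rightarrow> 'a \<Rightarrow> 'a \<Rightarrow> bool" where
  "adjacent G a b \<longleftrightarrow> {a, b} \<in> edges G"

definition connected_graph :: "'a graph \<Rightarrow> bool" where
  "connected_graph G \<longleftrightarrow>
     verts G \<noteq> {} \<and> (\<forall>a\<in>verts G. \<forall>b\<in>verts G. (adjacent G)\<^sup>*\<^sup>* a b)"

definition path_graph :: "nat \<Rightarrow> nat graph" where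
  "path_graph n = \<lparr>verts = {0..<n}, edges = {{i, i + 1} | i. i + 1 < n}\<rparr>"

text \<open>Meant for \<open>n \<ge> 3\<close>; for \<open>n = 1\<close> the formula below would produce a loop.\<close>

definition cycle_graph :: "nat \<Rightarrow> nat graph" where
  "cycle_graph n = \<lparr>verts = {0..<n}, edges = {{i, (i + 1) mod n} | i. i < n}\<rparr>"

definition join_graph :: "'a graph \<Rightarrow> 'b graph \<Rightarrow> ('a + 'b) graph" where
  "join_graph G H =
     \<lparr>verts = verts G <+> verts H,
      edges = (\<lambda>e. Inl ` e) ` edges G \<union> (\<lambda>e. Inr ` e) ` edges H
              \<union> {{Inl a, Inr b} | a b. a \<in> verts G \<and> b \<in> verts H}\<rparr>"

section \<open>Arithmetic cordial labelings\<close>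

text \<open>
  The function \<open>\<zeta>\<close> is only meaningful on integers coprime to \<open>\<eta>\<close>, and the operation
  \<open>star\<close> only on \<open>S\<close>; both are represented by total functions whose values elsewhere
  are unconstrained and never used.
\<close>

definition arithmetic_structure ::
  "nat \<Rightarrow> int set \<Rightarrow> (int \<Rightarrow> nat) \<Rightarrow> (int \<Rightarrow> int \<Rightarrow> int) \<Rightarrow> bool" where
  "arithmetic_structure \<eta> S \<zeta> star \<longleftrightarrow>
     0 < \<eta> \<and> \<zeta> \<in> {\<xi>. gcd \<xi> (int \<eta>) = 1} \<rightarrow> {0, 1}"

definition arith_label :: "nat \<Rightarrow> (int \<Rightarrow> nat) \<Rightarrow> int \<Rightarrow> nat" where
  "arith_label \<eta> \<zeta> x = (if gcd x (int \<eta>) \<noteq> 1 \<or> \<zeta> x = 0 then 0 else 1)"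

text \<open>
  The relation \<open>induced_labeling \<eta> \<zeta> star G f g\<close> says that \<open>g\<close> is the edge function induced
  by \<open>f\<close>.  Edges are unordered, so \<open>a\<close> and \<open>b\<close> range over both orientations of an edge:
  such a \<open>g\<close> exists exactly when the label of \<open>ab\<close> does not depend on the orientation
  (automatic for commutative \<open>star\<close>), and it is then unique on the edges.
\<close>

definition induced_labeling ::
  "nat \<Rightarrow> (int \<Rightarrow> nat) \<Rightarrow> (int \<Rightarrow> int \<Rightarrow> int) \<Rightarrow> 'a graph \<Rightarrow> ('a \<Rightarrow> int) \<Rightarrow> ('a set \<Rightarrow> nat) \<Rightarrow> bool"
  where
  "induced_labeling \<eta> \<zeta> star G f g \<longleftrightarrow>
     (\<forall>a b. {a, b} \<in> edges G \<longrightarrow> g {a, b} = arith_label \<eta> \<zeta> (star (f a) (f b)))"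

definition edge_count :: "'a graph \<Rightarrow> ('a set \<Rightarrow> nat) \<Rightarrow> nat \<Rightarrow> nat" where
  "edge_count G g i = card {e \<in> edges G. g e = i}"

definition arithmetic_cordial_labeling ::
  "nat \<Rightarrow> int set \<Rightarrow> (int \<Rightarrow> nat) \<Rightarrow> (int \<Rightarrow> int \<Rightarrow> int) \<Rightarrow> 'a graph \<Rightarrow> ('a \<Rightarrow> int) \<Rightarrow> bool"
  where
  "arithmetic_cordial_labeling \<eta> S \<zeta> star G f \<longleftrightarrow>
     bij_betw f (verts G) S \<and>
     (\<exists>g. induced_labeling \<eta> \<zeta> star G f g \<and>
          \<bar>int (edge_count G g 0) - int (edge_count G g 1)\<bar> \<le> 1)"

definition arithmetic_cordial_graph ::
  "nat \<Rightarrow> int set \<Rightarrow> (int \<Rightarrow> nat) \<Rightarrow> (int \<Rightarrow> int \<Rightarrow> int) \<Rightarrow> 'a graph \<Rightarrow> bool" where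
  "arithmetic_cordial_graph \<eta> S \<zeta> star G \<longleftrightarrow>
     arithmetic_structure \<eta> S \<zeta> star \<and> simple_graph G \<and> connected_graph G \<and>
     (\<exists>f. arithmetic_cordial_labeling \<eta> S \<zeta> star G f)"

end

theory Submission
  imports Defs
begin

text \<open>
  Since \<open>\<zeta> = (1 + \<chi>) / 2\<close> and \<open>\<chi>\<close> is multiplicative, the edge \<open>ab\<close> gets the label \<open>1\<close> or \<open>0\<close>
  according to whether \<open>\<chi> (f a) * \<chi> (f b)\<close> is \<open>1\<close> or \<open>-1\<close>.  Hence only the signs
  \<open>w v = \<chi> (f v)\<close> matter: the number of edges labelled \<open>1\<close> minus the number labelled \<open>0\<close> is the
  sum over all edges of the product of the two end signs.  Conversely, \<open>\<chi>\<close> takes each sign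
  equally often on \<open>S\<close>, so every sign pattern on the vertices with total sum \<open>0\<close> comes from a
  bijection onto \<open>S\<close> (\<open>bij_betw_preserving_sign\<close>).  The problem thus becomes to find a
  sign pattern with total sum \<open>0\<close> and edge sum in \<open>{-1, 0, 1}\<close>
  (\<open>arithmetic_cordial_graphI_sign\<close>).

  In a join the edges between the two parts contribute the product of the vertex sums of the
  parts (\<open>sum_edges_join_graph\<close>), so it is convenient to make both vertex sums zero.  With
  \<open>n = (p - 1) / 2\<close> divisible by \<open>4\<close>, the pattern \<open>+ + - -\<close> repeated around the cycle and along
  the path does this.  Consecutive signs alternately agree and disagree, so the cycle edges
  contribute \<open>0\<close>; the path lacks the last of these edges, a disagreeing one, and contributes
  \<open>1\<close>.  The total edge sum is \<open>1\<close>.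
\<close>

section \<open>Sign functions on finite sets\<close>

lemma card_signs:
  fixes \<sigma> :: "'a \<Rightarrow> int"
  assumes "finite A" and sgn: "\<And>x. x \<in> A \<Longrightarrow> \<sigma> x \<in> {-1, 1}"
  shows "int (card {x \<in> A. \<sigma> x = 1}) - int (card {x \<in> A. \<sigma> x = -1}) = sum \<sigma> A"
    and "int (card {x \<in> A. \<sigma> x = 1}) + int (card {x \<in> A. \<sigma> x = -1}) = int (card A)"
proof -
  have A: "A = {x \<in> A. \<sigma> x = 1} \<union> {x \<in> A. \<sigma> x = -1}"
    using sgn by auto
  have split: "sum h A = sum h {x \<in> A. \<sigma> x = 1} + sum h {x \<in> A. \<sigma> x = -1}" for h :: "'a \<Rightarrow> int"
    by (subst A, rule sum.union_disjoint) (use \<open>finite A\<close> in auto)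
  show "int (card {x \<in> A. \<sigma> x = 1}) - int (card {x \<in> A. \<sigma> x = -1}) = sum \<sigma> A"
    using split[of \<sigma>] by simp
  show "int (card {x \<in> A. \<sigma> x = 1}) + int (card {x \<in> A. \<sigma> x = -1}) = int (card A)"
    using split[of "\<lambda>_. 1"] by simp
qed

text \<open>
  The cardinality of a set and the sum of its signs determine how often each sign occurs, so
  the two sign classes can be matched separately.
\<close>

lemma bij_betw_preserving_sign:
  fixes \<sigma> :: "'a \<Rightarrow> int" and \<tau> :: "'b \<Rightarrow> int"
  assumes fin: "finite A" "finite B"
    and \<sigma>: "\<And>x. x \<in> A \<Longrightarrow> \<sigma> x \<in> {-1, 1}" and \<tau>: "\<And>y. y \<in> B \<Longrightarrow> \<tau> y \<in> {-1, 1}"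
    and "card A = card B" and "sum \<sigma> A = sum \<tau> B"
  obtains f where "bij_betw f A B" and "\<And>x. x \<in> A \<Longrightarrow> \<tau> (f x) = \<sigma> x"
proof -
  have "card {x \<in> A. \<sigma> x = 1} = card {y \<in> B. \<tau> y = 1}"
    "card {x \<in> A. \<sigma> x = -1} = card {y \<in> B. \<tau> y = -1}"
    using card_signs[of A \<sigma>] card_signs[of B \<tau>] assms by simp_all
  then obtain g h where g: "bij_betw g {x \<in> A. \<sigma> x = 1} {y \<in> B. \<tau> y = 1}"
    and h: "bij_betw h {x \<in> A. \<sigma> x = -1} {y \<in> B. \<tau> y = -1}"
    using finite_same_card_bij[of "{x \<in> A. \<sigma> x = 1}" "{y \<in> B. \<tau> y = 1}"]
      finite_same_card_bij[of "{x \<in> A. \<sigma> x = -1}" "{y \<in> B. \<tau> y = -1}"] fin by auto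
  define f where "f x = (if \<sigma> x = 1 then g x else h x)" for x
  have "bij_betw f {x \<in> A. \<sigma> x = 1} {y \<in> B. \<tau> y = 1}"
    using g by (rule bij_betw_cong[THEN iffD1, rotated]) (simp add: f_def)
  moreover have "bij_betw f {x \<in> A. \<sigma> x = -1} {y \<in> B. \<tau> y = -1}"
    using h by (rule bij_betw_cong[THEN iffD1, rotated]) (simp add: f_def)
  ultimately have "bij_betw f ({x \<in> A. \<sigma> x = 1} \<union> {x \<in> A. \<sigma> x = -1})
      ({y \<in> B. \<tau> y = 1} \<union> {y \<in> B. \<tau> y = -1})"
    by (rule bij_betw_combine) auto
  moreover have "{x \<in> A. \<sigma> x = 1} \<union> {x \<in> A. \<sigma> x = -1} = A"
    "{y \<in> B. \<tau> y = 1} \<union> {y \<in> B. \<tau> y = -1} = B"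
    using \<sigma> \<tau> by auto
  ultimately have "bij_betw f A B" by simp
  moreover have "\<tau> (f x) = \<sigma> x" if "x \<in> A" for x
    using \<sigma>[OF that] that bij_betwE[OF g] bij_betwE[OF h] by (auto simp: f_def)
  ultimately show thesis by (rule that)
qed

section \<open>Cordiality from a sign pattern\<close>

lemma simple_graph_finite_edges:
  assumes "simple_graph G" shows "finite (edges G)"
proof (rule finite_subset)
  show "edges G \<subseteq> Pow (verts G)" using assms by (auto simp: simple_graph_def)
  show "finite (Pow (verts G))" using assms by (simp add: simple_graph_def)
qed

text \<open>
  The sign of an edge is written \<open>prod w e\<close>, the product over its two end points, because this
  expression does not depend on an orientation of the edge.
\<close>

lemma arithmetic_cordial_graphI_sign:
  fixes \<chi> :: "int \<Rightarrow> int" and w :: "'a \<Rightarrow> int"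
  assumes G: "simple_graph G" "connected_graph G"
    and \<eta>: "0 < \<eta>"
    and \<zeta>: "\<zeta> \<in> {\<xi>. gcd \<xi> (int \<eta>) = 1} \<rightarrow> {0, 1}"
    and \<chi>: "\<chi> \<in> {\<xi>. gcd \<xi> (int \<eta>) = 1} \<rightarrow> {-1, 1}"
    and mult: "\<And>x y. gcd x (int \<eta>) = 1 \<Longrightarrow> gcd y (int \<eta>) = 1 \<Longrightarrow> \<chi> (x * y) = \<chi> x * \<chi> y"
    and \<zeta>\<chi>: "\<And>x. gcd x (int \<eta>) = 1 \<Longrightarrow> \<zeta> x = 1 \<longleftrightarrow> \<chi> x = 1"
    and S: "finite S" "\<And>x. x \<in> S \<Longrightarrow> gcd x (int \<eta>) = 1"
    and w: "\<And>v. v \<in> verts G \<Longrightarrow> w v \<in> {-1, 1}"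
    and "card (verts G) = card S" and "sum w (verts G) = sum \<chi> S"
    and bal: "\<bar>\<Sum>e\<in>edges G. prod w e\<bar> \<le> 1"
  shows "arithmetic_cordial_graph \<eta> S \<zeta> (\<lambda>x y. x * y) G"
proof -
  have "finite (verts G)" using G by (simp add: simple_graph_def)
  then obtain f where bij: "bij_betw f (verts G) S"
    and f: "\<And>v. v \<in> verts G \<Longrightarrow> \<chi> (f v) = w v"
    using bij_betw_preserving_sign[of "verts G" S w \<chi>] assms by blast
  have prod2: "prod w {a, b} = w a * w b" and ab: "a \<in> verts G" "b \<in> verts G"
    if "{a, b} \<in> edges G" for a b
  proof -
    have "card {a, b} = 2" "{a, b} \<subseteq> verts G" using that G by (auto simp: simple_graph_def)
    moreover from this have "a \<noteq> b" by auto
    ultimately show "prod w {a, b} = w a * w b" "a \<in> verts G" "b \<in> verts G" by auto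
  qed
  have sgn: "prod w e \<in> {-1, 1}" if "e \<in> edges G" for e
  proof -
    have "card e = 2" using that G by (simp add: simple_graph_def)
    then obtain a b where "e = {a, b}" by (auto simp: card_2_iff)
    with that prod2[of a b] ab[of a b] w[of a] w[of b] show ?thesis by auto
  qed
  define g where "g e = (if prod w e = 1 then 1 else 0 :: nat)" for e
  have "induced_labeling \<eta> \<zeta> (\<lambda>x y. x * y) G f g"
    unfolding induced_labeling_def
  proof (intro allI impI)
    fix a b assume e: "{a, b} \<in> edges G"
    have cop: "gcd (f a) (int \<eta>) = 1" "gcd (f b) (int \<eta>) = 1"
      using ab[OF e] bij_betwE[OF bij] S by auto
    then have "gcd (f a * f b) (int \<eta>) = 1"
      by (metis coprime_iff_gcd_eq_1 coprime_mult_left_iff)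
    moreover have "\<chi> (f a * f b) = prod w {a, b}"
      using mult[OF cop] f ab[OF e] prod2[OF e] by simp
    ultimately show "g {a, b} = arith_label \<eta> \<zeta> (f a * f b)"
      using \<zeta>\<chi>[of "f a * f b"] \<zeta> by (auto simp: g_def arith_label_def)
  qed
  moreover have "\<bar>int (edge_count G g 0) - int (edge_count G g 1)\<bar> \<le> 1"
  proof -
    have "{e \<in> edges G. g e = 1} = {e \<in> edges G. prod w e = 1}"
      "{e \<in> edges G. g e = 0} = {e \<in> edges G. prod w e = -1}"
      using sgn by (auto simp: g_def split: if_splits)
    then show ?thesis
      using card_signs(1)[of "edges G" "prod w"] sgn bal simple_graph_finite_edges[OF G(1)]
      by (simp add: edge_count_def)
  qed
  ultimately show ?thesis
    using G \<eta> \<zeta> bij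
    unfolding arithmetic_cordial_graph_def arithmetic_structure_def
      arithmetic_cordial_labeling_def by blast
qed

section \<open>Paths, cycles and joins\<close>

lemma simple_path_graph: "simple_graph (path_graph n)"
  by (auto simp: simple_graph_def path_graph_def)

lemma Suc_mod_neq: "2 \<le> n \<Longrightarrow> i < n \<Longrightarrow> Suc i mod n \<noteq> i"
  by (metis One_nat_def Suc_1 lessI mod_Suc mod_less n_not_Suc_n not_less zero_neq_one)

lemma simple_cycle_graph: "2 \<le> n \<Longrightarrow> simple_graph (cycle_graph n)"
  by (auto simp: simple_graph_def cycle_graph_def card_insert_if dest: Suc_mod_neq)

lemma simple_join_graph:
  assumes "simple_graph G" "simple_graph H"
  shows "simple_graph (join_graph G H)"
  using assms by (fastforce simp: simple_graph_def join_graph_def card_image)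

text \<open>
  A fixed vertex \<open>g\<close> of \<open>G\<close> serves as hub: it is adjacent to all of \<open>H\<close>, and it reaches the
  other vertices of \<open>G\<close> in two steps through any vertex of \<open>H\<close>.
\<close>

lemma connected_join_graph:
  assumes "verts G \<noteq> {}" "verts H \<noteq> {}"
  shows "connected_graph (join_graph G H)"
proof -
  let ?J = "join_graph G H"
  obtain g h where gh: "g \<in> verts G" "h \<in> verts H" using assms by auto
  have LR: "adjacent ?J (Inl a) (Inr b)" and RL: "adjacent ?J (Inr b) (Inl a)"
    if "a \<in> verts G" "b \<in> verts H" for a b
    using that by (auto simp: adjacent_def join_graph_def insert_commute)
  have from_g: "(adjacent ?J)\<^sup>*\<^sup>* (Inl g) v" and to_g: "(adjacent ?J)\<^sup>*\<^sup>* v (Inl g)"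
    if "v \<in> verts ?J" for v
  proof -
    consider a where "v = Inl a" "a \<in> verts G" | b where "v = Inr b" "b \<in> verts H"
      using \<open>v \<in> verts ?J\<close> by (auto simp: join_graph_def)
    then have "(adjacent ?J)\<^sup>*\<^sup>* (Inl g) v \<and> (adjacent ?J)\<^sup>*\<^sup>* v (Inl g)"
    proof cases
      case 1
      then show ?thesis using gh LR RL by (meson converse_rtranclp_into_rtranclp r_into_rtranclp)
    next
      case 2
      then show ?thesis using gh LR RL by (meson r_into_rtranclp)
    qed
    then show "(adjacent ?J)\<^sup>*\<^sup>* (Inl g) v" "(adjacent ?J)\<^sup>*\<^sup>* v (Inl g)" by auto
  qed
  show ?thesis
    unfolding connected_graph_def
    using from_g to_g gh by (auto simp: join_graph_def intro: rtranclp_trans)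
qed

lemma sum_edges_path_graph:
  fixes s :: "nat \<Rightarrow> int"
  shows "(\<Sum>e\<in>edges (path_graph n). prod s e) = (\<Sum>i<n - 1. s i * s (Suc i))"
proof -
  have "edges (path_graph n) = (\<lambda>i. {i, Suc i}) ` {..<n - 1}"
    by (auto simp: path_graph_def)
  moreover have "inj_on (\<lambda>i. {i, Suc i}) {..<n - 1}"
    by (auto simp: inj_on_def doubleton_eq_iff)
  ultimately show ?thesis by (simp add: sum.reindex)
qed

lemma sum_edges_cycle_graph:
  fixes s :: "nat \<Rightarrow> int"
  assumes "3 \<le> n"
  shows "(\<Sum>e\<in>edges (cycle_graph n). prod s e) = (\<Sum>i<n. s i * s (Suc i mod n))"
proof -
  have "edges (cycle_graph n) = (\<lambda>i. {i, Suc i mod n}) ` {..<n}"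
    by (auto simp: cycle_graph_def)
  \<comment> \<open>For \<open>n = 2\<close> the two indices would give the same edge.\<close>
  moreover have "inj_on (\<lambda>i. {i, Suc i mod n}) {..<n}"
    using assms by (auto simp: inj_on_def doubleton_eq_iff mod_Suc split: if_splits)
  moreover have "prod s {i, Suc i mod n} = s i * s (Suc i mod n)" if "i < n" for i
    using Suc_mod_neq[of n i] that assms by simp
  ultimately show ?thesis by (simp add: sum.reindex)
qed

lemma sum_edges_join_graph:
  fixes w :: "'a + 'b \<Rightarrow> int"
  assumes G: "simple_graph G" and H: "simple_graph H"
  shows "(\<Sum>e\<in>edges (join_graph G H). prod w e) =
    (\<Sum>e\<in>edges G. prod (w \<circ> Inl) e) + (\<Sum>e\<in>edges H. prod (w \<circ> Inr) e)
    + (\<Sum>a\<in>verts G. w (Inl a)) * (\<Sum>b\<in>verts H. w (Inr b))"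
proof -
  let ?L = "(\<lambda>e. (Inl :: 'a \<Rightarrow> 'a + 'b) ` e) ` edges G"
  let ?R = "(\<lambda>e. (Inr :: 'b \<Rightarrow> 'a + 'b) ` e) ` edges H"
  let ?m = "\<lambda>(a, b). {Inl a, Inr b} :: ('a + 'b) set"
  let ?M = "?m ` (verts G \<times> verts H)"
  have edges: "edges (join_graph G H) = ?L \<union> ?R \<union> ?M"
    by (auto simp: join_graph_def)
  have fin: "finite (verts G)" "finite (verts H)" "finite (edges G)" "finite (edges H)"
    using G H simple_graph_finite_edges by (auto simp: simple_graph_def)
  have "{} \<notin> edges G" using G by (auto simp: simple_graph_def)
  moreover have "A = {}" if "(Inl :: 'a \<Rightarrow> 'a + 'b) ` A = Inr ` B" for A B
    using that by blast
  ultimately have LR: "?L \<inter> ?R = {}" by auto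
  have "?L \<inter> ?M = {}" "?R \<inter> ?M = {}" by auto
  then have LRM: "(?L \<union> ?R) \<inter> ?M = {}" by blast
  have inj: "inj_on (\<lambda>e. (Inl :: 'a \<Rightarrow> 'a + 'b) ` e) (edges G)"
    "inj_on (\<lambda>e. (Inr :: 'b \<Rightarrow> 'a + 'b) ` e) (edges H)"
    by (auto simp: inj_on_def inj_image_eq_iff)
  have "inj_on ?m (verts G \<times> verts H)" by (auto simp: inj_on_def doubleton_eq_iff)
  then have "(\<Sum>e\<in>?M. prod w e) = (\<Sum>(a, b)\<in>verts G \<times> verts H. w (Inl a) * w (Inr b))"
    by (simp add: sum.reindex split_def)
  then have "(\<Sum>e\<in>?M. prod w e) = (\<Sum>a\<in>verts G. w (Inl a)) * (\<Sum>b\<in>verts H. w (Inr b))"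
    by (simp add: sum_product sum.cartesian_product)
  moreover have "(\<Sum>e\<in>?L. prod w e) = (\<Sum>e\<in>edges G. prod (w \<circ> Inl) e)"
    "(\<Sum>e\<in>?R. prod w e) = (\<Sum>e\<in>edges H. prod (w \<circ> Inr) e)"
    using inj by (simp_all add: sum.reindex prod.reindex)
  ultimately show ?thesis
    unfolding edges using fin LR LRM by (simp add: sum.union_disjoint)
qed

section \<open>The pattern of period four\<close>

definition block_sign :: "nat \<Rightarrow> int" where
  "block_sign i = (if i mod 4 < 2 then 1 else -1)"

lemma block_sign_cases: "block_sign i \<in> {-1, 1}"
  by (simp add: block_sign_def)

lemma block_sign_mod: "4 dvd n \<Longrightarrow> block_sign (i mod n) = block_sign i"
  by (simp add: block_sign_def mod_mod_cancel)

lemma block_sign_block: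
  "block_sign (4 * k) = 1" "block_sign (Suc (4 * k)) = 1"
  "block_sign (Suc (Suc (4 * k))) = -1" "block_sign (Suc (Suc (Suc (4 * k)))) = -1"
  "block_sign (Suc (Suc (Suc (Suc (4 * k))))) = 1"
  unfolding block_sign_def by presburger+

lemma sum_lessThan_four_Suc:
  fixes h :: "nat \<Rightarrow> int"
  shows "(\<Sum>i<4 * Suc k. h i) = (\<Sum>i<4 * k. h i)
    + h (4 * k) + h (Suc (4 * k)) + h (Suc (Suc (4 * k))) + h (Suc (Suc (Suc (4 * k))))"
proof -
  have "4 * Suc k = Suc (Suc (Suc (Suc (4 * k))))" by simp
  then show ?thesis by (simp only: sum.lessThan_Suc)
qed

lemma sum_block_sign: "4 dvd n \<Longrightarrow> (\<Sum>i<n. block_sign i) = 0"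
proof (elim dvdE)
  fix k assume "n = 4 * k"
  moreover have "(\<Sum>i<4 * k. block_sign i) = 0"
    by (induction k) (simp_all only: sum_lessThan_four_Suc, simp_all add: block_sign_block)
  ultimately show ?thesis by simp
qed

lemma sum_block_sign_consecutive:
  "4 dvd n \<Longrightarrow> (\<Sum>i<n. block_sign i * block_sign (Suc i)) = 0"
proof (elim dvdE)
  fix k assume "n = 4 * k"
  moreover have "(\<Sum>i<4 * k. block_sign i * block_sign (Suc i)) = 0"
    by (induction k) (simp_all only: sum_lessThan_four_Suc, simp_all add: block_sign_block)
  ultimately show ?thesis by simp
qed

text \<open>
  Of the \<open>n\<close> consecutive pairs summed above, the path omits the pair of indices \<open>n - 1\<close> and \<open>n\<close>, which is a
  step from \<open>-\<close> to \<open>+\<close>.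
\<close>

lemma sum_edges_path_block_sign:
  assumes "4 dvd n" "0 < n"
  shows "(\<Sum>e\<in>edges (path_graph n). prod block_sign e) = 1"
proof -
  obtain m where m: "n = Suc m" using \<open>0 < n\<close> by (cases n) auto
  with \<open>4 dvd n\<close> have "m mod 4 = 3" "Suc m mod 4 = 0" by presburger+
  then have "block_sign m * block_sign (Suc m) = -1"
    unfolding block_sign_def by simp
  with sum_block_sign_consecutive[OF \<open>4 dvd n\<close>] show ?thesis
    by (simp add: sum_edges_path_graph m)
qed

lemma sum_edges_cycle_block_sign:
  assumes "4 dvd n" "0 < n"
  shows "(\<Sum>e\<in>edges (cycle_graph n). prod block_sign e) = 0"
proof -
  have "3 \<le> n" using assms by (auto elim!: dvdE)
  then show ?thesis
    using assms by (simp add: sum_edges_cycle_graph block_sign_mod sum_block_sign_consecutive)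
qed

section \<open>The join of a path and a cycle\<close>

theorem theorem5p3:
  fixes p :: nat and \<zeta> :: "int \<Rightarrow> nat" and \<chi> :: "int \<Rightarrow> int" and S :: "int set"
  assumes "prime p" and "p \<ge> 17"
    and "[(p - 1) div 2 = 0] (mod 4)"
    and "\<zeta> \<in> {\<xi>. gcd \<xi> (int p) = 1} \<rightarrow> {0, 1}"
    and "\<And>\<theta>\<^sub>1 \<theta>\<^sub>2. gcd \<theta>\<^sub>1 (int p) = 1 \<Longrightarrow> gcd \<theta>\<^sub>2 (int p) = 1 \<Longrightarrow> [\<theta>\<^sub>1 = \<theta>\<^sub>2] (mod int p)
           \<Longrightarrow> \<zeta> \<theta>\<^sub>1 = \<zeta> \<theta>\<^sub>2"
    and "card {a. \<zeta> a = 0 \<and> 1 \<le> a \<and> a \<le> int p - 1} = (p - 1) div 2"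
    and "card {a. \<zeta> a = 1 \<and> 1 \<le> a \<and> a \<le> int p - 1} = (p - 1) div 2"
    and "\<chi> \<in> {\<xi>. gcd \<xi> (int p) = 1} \<rightarrow> {- 1, 1}"
    and "\<And>\<theta>\<^sub>1 \<theta>\<^sub>2. gcd \<theta>\<^sub>1 (int p) = 1 \<Longrightarrow> gcd \<theta>\<^sub>2 (int p) = 1
           \<Longrightarrow> \<chi> (\<theta>\<^sub>1 * \<theta>\<^sub>2) = \<chi> \<theta>\<^sub>1 * \<chi> \<theta>\<^sub>2"
    and "\<And>\<theta>. gcd \<theta> (int p) = 1 \<Longrightarrow> real (\<zeta> \<theta>) = (1 + real_of_int (\<chi> \<theta>)) / 2"
    and "S = {1..int p - 1}"
  shows "arithmetic_cordial_graph p S \<zeta> (\<lambda>x y. x * y)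
           (join_graph (path_graph ((p - 1) div 2)) (cycle_graph ((p - 1) div 2)))"
proof -
  note \<chi> = assms(8)
  define n where "n = (p - 1) div 2"
  have n: "4 dvd n" "0 < n" "2 \<le> n"
    using assms(2,3) by (simp_all add: n_def cong_0_iff)
  have cop: "gcd x (int p) = 1" if "x \<in> S" for x
  proof -
    have "\<not> int p dvd x" using that assms(11) zdvd_not_zless[of x "int p"] by auto
    then have "coprime (int p) x" using \<open>prime p\<close> by (intro prime_imp_coprime) simp_all
    then show ?thesis by (simp add: coprime_iff_gcd_eq_1 gcd.commute)
  qed
  have \<zeta>\<chi>: "\<zeta> x = 1 \<longleftrightarrow> \<chi> x = 1" "\<zeta> x = 0 \<longleftrightarrow> \<chi> x = -1" if "gcd x (int p) = 1" for x
    using assms(10)[OF that] \<chi> that by auto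
  have "{x \<in> S. \<chi> x = 1} = {a. \<zeta> a = 1 \<and> 1 \<le> a \<and> a \<le> int p - 1}"
    "{x \<in> S. \<chi> x = -1} = {a. \<zeta> a = 0 \<and> 1 \<le> a \<and> a \<le> int p - 1}"
    using \<zeta>\<chi> cop assms(11) by auto
  then have cards: "card {x \<in> S. \<chi> x = 1} = n" "card {x \<in> S. \<chi> x = -1} = n"
    using assms(6,7) by (simp_all add: n_def)
  have "finite S" using assms(11) by simp
  moreover have "\<chi> x \<in> {-1, 1}" if "x \<in> S" for x using cop[OF that] \<chi> by auto
  ultimately have S: "sum \<chi> S = 0" "card S = 2 * n"
    using card_signs[of S \<chi>] cards by simp_all
  let ?P = "path_graph n" and ?C = "cycle_graph n"
  define w :: "nat + nat \<Rightarrow> int" where "w = case_sum block_sign block_sign"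
  have w: "w \<circ> Inl = block_sign" "w \<circ> Inr = block_sign"
    by (auto simp: w_def)
  have verts: "verts ?P = {..<n}" "verts ?C = {..<n}"
    by (auto simp: path_graph_def cycle_graph_def)
  then have vJ: "verts (join_graph ?P ?C) = {..<n} <+> {..<n}"
    by (simp add: join_graph_def)
  have simple: "simple_graph ?P" "simple_graph ?C"
    using simple_path_graph simple_cycle_graph n by auto
  have "arithmetic_cordial_graph p S \<zeta> (\<lambda>x y. x * y) (join_graph ?P ?C)"
  proof (rule arithmetic_cordial_graphI_sign[where \<chi> = \<chi> and w = w])
    show "simple_graph (join_graph ?P ?C)" using simple by (rule simple_join_graph)
    show "connected_graph (join_graph ?P ?C)"
      using n(2) by (intro connected_join_graph) (simp_all add: verts lessThan_empty_iff)
    show "w v \<in> {-1, 1}" for v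
      using block_sign_cases by (cases v) (auto simp: w_def)
    show "card (verts (join_graph ?P ?C)) = card S"
      using S by (simp add: vJ card_Plus)
    show "sum w (verts (join_graph ?P ?C)) = sum \<chi> S"
      using S sum_block_sign[OF n(1)] by (simp add: vJ sum.Plus w_def)
    have "(\<Sum>e\<in>edges (join_graph ?P ?C). prod w e) = 1"
      using sum_edges_path_block_sign[OF n(1,2)] sum_edges_cycle_block_sign[OF n(1,2)]
        sum_block_sign[OF n(1)]
      by (subst sum_edges_join_graph[OF simple]) (simp add: w verts, simp add: w_def)
    then show "\<bar>\<Sum>e\<in>edges (join_graph ?P ?C). prod w e\<bar> \<le> 1" by simp
    show "0 < p" using assms(2) by simp
  qed (fact assms(4,8,9) \<zeta>\<chi>(1) cop \<open>finite S\<close> | assumption)+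
  then show ?thesis by (simp add: n_def)
qed

end
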